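(* Let $\lambda,\mu>0$, $\rho=\lambda/\mu$, and let $(P_t)_{t\ge0}$ be the $M/M/\infty$ semi-group with parameters $\lambda,\mu$. Let $f\colon\mathbb{N}\to\mathbb{R}^+$ be not identically vanishing. Then for all $t>0$, $$\Delta\log P_tf(n)\ \ge\ \log\left(\frac{1}{12}\left(1-\frac{p^2}{(p+\rho(1-p)^2)^2}\right)\right),\qquad n=1,2,\dots$$ with $p=p(t)=e^{-\mu t}$.
   Context: $\mathbb{N}=\{0,1,2,\dots\}$ and $\mathbb{R}^+=[0,\infty)$. For $g\colon\mathbb{N}\to\mathbb{R}$ and $n\ge1$, $\Delta g(n):=g(n+1)+g(n-1)-2g(n)$. The $M/M/\infty$ process with parameters $\lambda,\mu>0$ is the Markov jump process on $\mathbb{N}$ with generator $Lf(n)=n\mu[f(n-1)-f(n)]+\lambda[f(n+1)-f(n)]$. Its semi-group is $P_tf(n)=\mathbb{E}(f(Y_t+Z_t))$, where $Y_t\sim\mathcal{B}(n,p(t))$ (binomial, $p(t)=e^{-\mu t}$) and $Z_t$ is Poisson with mean $\rho(1-p(t))$, independent of $Y_t$. When $P_tf$ may take the value $+\infty$, the inequality $\Delta\log P_tf(n)\ge\kappa$ is understood as $P_tf(n+1)P_tf(n-1)\ge e^{\kappa}P_tf(n)^2$ in $[0,\infty]$. *)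

theory Defs
  imports "HOL-Probability.Probability"
begin

definition Delta :: "(nat \<Rightarrow> real) \<Rightarrow> nat \<Rightarrow> real" where
  "Delta g n = g (n + 1) + g (n - 1) - 2 * g n"

(* Law at time t of the M/M/infinity process with parameters lam, mu, started at n: the law of
   Y + Z with Y ~ B(n, p(t)) and Z ~ Poisson(rho (1 - p(t))) independent.  The case t = 0 is
   separate because poisson_pmf is specified only for strictly positive rates. *)
definition mm_inf_pmf :: "real \<Rightarrow> real \<Rightarrow> real \<Rightarrow> nat \<Rightarrow> nat pmf" where
  "mm_inf_pmf lam \<mu> t n =
     (if t = 0 then return_pmf n
      else map_pmf (\<lambda>(y, z). y + z)
             (pair_pmf (binomial_pmf n (exp (- \<mu> * t)))
                       (poisson_pmf (lam / \<mu> * (1 - exp (- \<mu> * t))))))"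

(* Values in [0, infinity]: f need not be integrable. *)
definition mm_inf_semigroup ::
  "real \<Rightarrow> real \<Rightarrow> real \<Rightarrow> (nat \<Rightarrow> real) \<Rightarrow> nat \<Rightarrow> ennreal" where
  "mm_inf_semigroup lam \<mu> t f n = (\<integral>\<^sup>+ k. ennreal (f k) \<partial>measure_pmf (mm_inf_pmf lam \<mu> t n))"

(* "Delta log g (n) >= kappa" for g with values in [0, infinity]: the product form, and in
   addition the literal inequality wherever the three values involved are finite. *)
definition Delta_log_ge :: "(nat \<Rightarrow> ennreal) \<Rightarrow> nat \<Rightarrow> real \<Rightarrow> bool" where
  "Delta_log_ge g n \<kappa> \<longleftrightarrow>
     g (n + 1) * g (n - 1) \<ge> ennreal (exp \<kappa>) * g n ^ 2 \<and>
     (g (n - 1) < \<infinity> \<and> g n < \<infinity> \<and> g (n + 1) < \<infinity> \<longrightarrow>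
        Delta (\<lambda>m. ln (enn2real (g m))) n \<ge> \<kappa>)"

end

theory Submission
  imports Defs
begin

text \<open>
  By the Cauchy--Schwarz inequality in the form
  \<open>(\<Sum>k. f k * sqrt (q\<^sub>1 k * q\<^sub>2 k))\<^sup>2 \<le> (\<Sum>k. f k * q\<^sub>1 k) * (\<Sum>k. f k * q\<^sub>2 k)\<close>, a lower bound
  \<open>c * q\<^sub>n k ^ 2 \<le> q\<^sub>n\<^sub>+\<^sub>1 k * q\<^sub>n\<^sub>-\<^sub>1 k\<close> on the transition kernel, pointwise in the arrival state \<open>k\<close>,
  passes to \<open>P\<^sub>t f\<close> for every \<open>f \<ge> 0\<close>, with the same constant and including infinite values
  (\<open>nn_integral_pmf_log_convex\<close>).

  Fix \<open>n \<ge> 1\<close> and write \<open>r = 1 - p\<close>, \<open>\<theta> = \<rho> * r\<close>, and \<open>A\<close>, \<open>B\<close>, \<open>D\<close> for the mass that the kernel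
  started at \<open>n - 1\<close> gives to \<open>k\<close>, \<open>k - 1\<close>, \<open>k - 2\<close>. Adding Bernoulli variables to the binomial
  part gives the masses \<open>p * B + r * A\<close> and \<open>p\<^sup>2 * D + 2 * p * r * B + r\<^sup>2 * A\<close> of \<open>k\<close> from \<open>n\<close> and
  from \<open>n + 1\<close>. Now \<open>B = \<Sum>i\<le>k-1. b\<^sub>i * \<pi>\<^sub>k\<^sub>-\<^sub>1\<^sub>-\<^sub>i\<close> is the convolution of the binomial
  weights \<open>b\<^sub>i\<close> with parameters \<open>n - 1\<close> and \<open>p\<close> and the Poisson weights \<open>\<pi>\<^sub>j\<close> of mean \<open>\<theta>\<close>.
  Let \<open>e = b\<^sub>k\<^sub>-\<^sub>1 * \<pi>\<^sub>0\<close> be its last term. Then \<open>A \<ge> b\<^sub>k\<^sub>-\<^sub>1 * \<pi>\<^sub>1 = \<theta> * e\<close>, and, since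
  \<open>\<pi>\<^sub>j\<^sub>+\<^sub>2 * \<pi>\<^sub>j \<ge> \<pi>\<^sub>j\<^sub>+\<^sub>1\<^sup>2 / 2\<close>, Cauchy--Schwarz applied to the other terms gives
  \<open>A * D \<ge> (B - e)\<^sup>2 / 2\<close>. If \<open>e \<le> B / 2\<close> the second bound yields \<open>A * D \<ge> B\<^sup>2 / 8\<close>; otherwise the
  first one yields \<open>A \<ge> \<theta> * B / 2\<close>. Either suffices (\<open>kernel_quadratic_bound\<close>). For \<open>k = 1\<close> this
  holds with \<open>D = 0\<close> and \<open>e = B\<close>, and for \<open>k = 0\<close> the claim reduces to \<open>c \<le> 1\<close>.
\<close>

section \<open>Cauchy--Schwarz for integrals against probability mass functions\<close>

lemma nn_integral_pmf_log_convex: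
  fixes q1 q q2 :: "'a pmf" and f :: "'a \<Rightarrow> real" and c :: real
  assumes f: "\<And>k. f k \<ge> 0" and c: "c \<ge> 0"
    and ker: "\<And>k. c * (pmf q k)\<^sup>2 \<le> pmf q1 k * pmf q2 k"
  shows "ennreal c * (\<integral>\<^sup>+k. ennreal (f k) \<partial>measure_pmf q)\<^sup>2
    \<le> (\<integral>\<^sup>+k. ennreal (f k) \<partial>measure_pmf q1) * (\<integral>\<^sup>+k. ennreal (f k) \<partial>measure_pmf q2)"
proof -
  let ?I = "\<lambda>g. \<integral>\<^sup>+k. ennreal (g k) \<partial>count_space UNIV"
  have int: "(\<integral>\<^sup>+k. ennreal (f k) \<partial>measure_pmf m) = ?I (\<lambda>k. f k * pmf m k)" for m :: "'a pmf"
    using f by (simp add: nn_integral_measure_pmf ennreal_mult' mult.commute)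
  let ?g = "\<lambda>m k. sqrt (f k * pmf m k)"
  have sq: "?I (\<lambda>k. f k * pmf m k) = (\<integral>\<^sup>+k. (ennreal (?g m k))\<^sup>2 \<partial>count_space UNIV)" for m :: "'a pmf"
    using f by (intro nn_integral_cong) (simp add: ennreal_power)
  have pt: "sqrt c * (f k * pmf q k) \<le> ?g q1 k * ?g q2 k" for k
  proof -
    have "sqrt c * pmf q k = sqrt (c * (pmf q k)\<^sup>2)"
      by (simp add: real_sqrt_mult)
    also have "\<dots> \<le> sqrt (pmf q1 k * pmf q2 k)"
      using ker by simp
    finally have "f k * (sqrt c * pmf q k) \<le> f k * sqrt (pmf q1 k * pmf q2 k)"
      using f by (intro mult_left_mono)
    also have "\<dots> = ?g q1 k * ?g q2 k"
      using f[of k] by (simp add: real_sqrt_mult)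
    finally show ?thesis by (simp add: mult_ac)
  qed
  have "ennreal c * (?I (\<lambda>k. f k * pmf q k))\<^sup>2 = (ennreal (sqrt c) * ?I (\<lambda>k. f k * pmf q k))\<^sup>2"
    using c by (simp add: power_mult_distrib ennreal_power)
  also have "ennreal (sqrt c) * ?I (\<lambda>k. f k * pmf q k) = ?I (\<lambda>k. sqrt c * (f k * pmf q k))"
    using c f by (simp add: nn_integral_cmult ennreal_mult')
  also have "(?I (\<lambda>k. sqrt c * (f k * pmf q k)))\<^sup>2 \<le> (?I (\<lambda>k. ?g q1 k * ?g q2 k))\<^sup>2"
    using pt by (intro power_mono nn_integral_mono ennreal_leI) auto
  also have "?I (\<lambda>k. ?g q1 k * ?g q2 k)
      = (\<integral>\<^sup>+k. ennreal (?g q1 k) * ennreal (?g q2 k) \<partial>count_space UNIV)"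
    using f by (intro nn_integral_cong) (simp add: ennreal_mult)
  also have "\<dots>\<^sup>2 \<le> ?I (\<lambda>k. f k * pmf q1 k) * ?I (\<lambda>k. f k * pmf q2 k)"
    unfolding sq by (rule Cauchy_Schwarz_nn_integral) auto
  finally show ?thesis unfolding int .
qed

lemma nn_integral_pmf_pos:
  fixes f :: "'a \<Rightarrow> real"
  assumes "f k > 0" and "pmf q k > 0"
  shows "(\<integral>\<^sup>+k. ennreal (f k) \<partial>measure_pmf q) > 0"
proof -
  have "k \<in> set_pmf q" using assms(2) by (simp add: set_pmf_iff)
  hence "\<not> (AE k in measure_pmf q. ennreal (f k) = 0)"
    using assms(1) by (auto simp: AE_measure_pmf_iff ennreal_eq_0_iff not_le)
  thus ?thesis
    by (subst zero_less_iff_neq_zero, subst nn_integral_0_iff_AE) auto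
qed

section \<open>Convolution with a Poisson law\<close>

lemma pmf_sum_pair_nat:
  fixes M N :: "nat pmf"
  shows "pmf (map_pmf (\<lambda>(y, z). y + z) (pair_pmf M N)) k = (\<Sum>i\<le>k. pmf M i * pmf N (k - i))"
proof -
  have "(\<lambda>(y, z). y + z) -` {k} = (\<lambda>i. (i, k - i)) ` {..k}"
    by force
  hence "pmf (map_pmf (\<lambda>(y, z). y + z) (pair_pmf M N)) k
      = measure (pair_pmf M N) ((\<lambda>i. (i, k - i)) ` {..k})"
    by (simp add: pmf_map)
  also have "\<dots> = (\<Sum>x\<in>(\<lambda>i. (i, k - i)) ` {..k}. pmf (pair_pmf M N) x)"
    by (rule measure_measure_pmf_finite) simp
  also have "\<dots> = (\<Sum>i\<le>k. pmf M i * pmf N (k - i))"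
    by (subst sum.reindex) (auto simp: inj_on_def pmf_pair)
  finally show ?thesis .
qed

lemma pmf_poisson_Suc_mult_ge:
  assumes "\<theta> > 0"
  shows "(pmf (poisson_pmf \<theta>) (Suc j))\<^sup>2 / 2
    \<le> pmf (poisson_pmf \<theta>) (Suc (Suc j)) * pmf (poisson_pmf \<theta>) j"
proof -
  let ?\<pi> = "pmf (poisson_pmf \<theta>)"
  have S: "?\<pi> (Suc i) = \<theta> / real (Suc i) * ?\<pi> i" for i
    using assms by (simp add: field_simps)
  have "?\<pi> (Suc (Suc j)) * ?\<pi> j = (\<theta> / real (Suc j) * ?\<pi> j)\<^sup>2 * (real (Suc j) / real (Suc (Suc j)))"
    unfolding S by (simp add: power2_eq_square mult_ac del: pmf_poisson)
  also have "\<dots> \<ge> (\<theta> / real (Suc j) * ?\<pi> j)\<^sup>2 * (1 / 2)"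
    by (intro mult_left_mono) (auto simp: field_simps)
  finally show ?thesis unfolding S[of j] by simp
qed

text \<open>
  The two bounds on the law of \<open>Y + Z\<close>, with \<open>Z\<close> Poisson and independent of \<open>Y\<close>, where
  \<open>e\<close> is the contribution of \<open>Z = 0\<close> to the mass of \<open>k\<close>. The law of \<open>Y\<close> is arbitrary.
\<close>

lemma poisson_convolution_bounds:
  fixes M :: "nat pmf" and \<theta> :: real
  assumes \<theta>: "\<theta> > 0"
  defines "a \<equiv> pmf (map_pmf (\<lambda>(y, z). y + z) (pair_pmf M (poisson_pmf \<theta>)))"
  defines "e \<equiv> \<lambda>k. pmf M k * pmf (poisson_pmf \<theta>) 0"
  shows conv_ge_term: "\<theta> * e k \<le> a (Suc k)"
    and conv_zero: "a 0 = e 0"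
    and conv_log_convex: "(a (Suc k) - e (Suc k))\<^sup>2 / 2 \<le> a (Suc (Suc k)) * a k"
proof -
  let ?b = "pmf M" and ?\<pi> = "pmf (poisson_pmf \<theta>)"
  have a: "a k = (\<Sum>i\<le>k. ?b i * ?\<pi> (k - i))" for k
    unfolding a_def by (rule pmf_sum_pair_nat)
  show "a 0 = e 0" by (simp add: a e_def)
  have "\<theta> * e k = ?b k * ?\<pi> (Suc k - k)"
    using \<theta> by (simp add: e_def)
  also have "\<dots> \<le> a (Suc k)"
    unfolding a by (rule member_le_sum) auto
  finally show "\<theta> * e k \<le> a (Suc k)" .
  \<comment> \<open>The bound on \<open>a (Suc (Suc k)) * a k\<close> comes from pairing the terms with the same \<open>i\<close>,
    after dropping \<open>i > k\<close> from the first sum.\<close>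
  define u where "u i = sqrt (?b i * ?\<pi> (Suc (Suc k) - i))" for i
  define v where "v i = sqrt (?b i * ?\<pi> (k - i))" for i
  have uv: "?b i * ?\<pi> (Suc k - i) / sqrt 2 \<le> u i * v i" if "i \<le> k" for i
  proof -
    have "?\<pi> (Suc k - i) / sqrt 2 = sqrt ((?\<pi> (Suc (k - i)))\<^sup>2 / 2)"
      using that by (simp add: real_sqrt_divide Suc_diff_le del: pmf_poisson)
    also have "\<dots> \<le> sqrt (?\<pi> (Suc (Suc (k - i))) * ?\<pi> (k - i))"
      using pmf_poisson_Suc_mult_ge[OF \<theta>] by (rule real_sqrt_le_mono)
    finally have "?b i * (?\<pi> (Suc k - i) / sqrt 2)
        \<le> ?b i * sqrt (?\<pi> (Suc (Suc (k - i))) * ?\<pi> (k - i))"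
      by (rule mult_left_mono) simp
    also have "\<dots> = u i * v i"
      using that by (simp add: u_def v_def real_sqrt_mult Suc_diff_le)
    finally show ?thesis by simp
  qed
  have "(a (Suc k) - e (Suc k))\<^sup>2 / 2 = ((\<Sum>i\<le>k. ?b i * ?\<pi> (Suc k - i)) / sqrt 2)\<^sup>2"
    by (simp add: a e_def power_divide del: pmf_poisson)
  also have "\<dots> = (\<Sum>i\<le>k. ?b i * ?\<pi> (Suc k - i) / sqrt 2)\<^sup>2"
    by (simp only: sum_divide_distrib)
  also have "\<dots> \<le> (\<Sum>i\<le>k. u i * v i)\<^sup>2"
    using uv by (intro power_mono sum_mono sum_nonneg) auto
  also have "\<dots> \<le> (\<Sum>i\<le>k. (u i)\<^sup>2) * (\<Sum>i\<le>k. (v i)\<^sup>2)"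
    by (rule Cauchy_Schwarz_ineq_sum)
  also have "(\<Sum>i\<le>k. (v i)\<^sup>2) = a k"
    by (simp add: v_def a del: pmf_poisson)
  also have "(\<Sum>i\<le>k. (u i)\<^sup>2) * a k \<le> a (Suc (Suc k)) * a k"
  proof (rule mult_right_mono)
    have "(\<Sum>i\<le>k. (u i)\<^sup>2) = (\<Sum>i\<le>k. ?b i * ?\<pi> (Suc (Suc k) - i))"
      by (simp add: u_def del: pmf_poisson)
    also have "\<dots> \<le> a (Suc (Suc k))"
      unfolding a by (rule sum_mono2) auto
    finally show "(\<Sum>i\<le>k. (u i)\<^sup>2) \<le> a (Suc (Suc k))" .
    show "a k \<ge> 0" by (simp add: a_def)
  qed
  finally show "(a (Suc k) - e (Suc k))\<^sup>2 / 2 \<le> a (Suc (Suc k)) * a k" .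
qed

section \<open>The kernel of the M/M/infinity process\<close>

text \<open>
  Conditioning on one of the \<open>n + 1\<close> initial customers, who is still present with probability \<open>p\<close>.
\<close>

lemma pmf_binomial_sum_Suc:
  fixes N :: "nat pmf"
  assumes p: "0 \<le> p" "p \<le> 1"
  defines "q \<equiv> \<lambda>n. pmf (map_pmf (\<lambda>(y, z). y + z) (pair_pmf (binomial_pmf n p) N))"
  shows "q (Suc n) 0 = (1 - p) * q n 0"
    and "q (Suc n) (Suc k) = p * q n k + (1 - p) * q n (Suc k)"
proof -
  let ?Q = "\<lambda>n. map_pmf (\<lambda>(y, z). y + z) (pair_pmf (binomial_pmf n p) N)"
  have *: "?Q (Suc n) = bernoulli_pmf p \<bind> (\<lambda>b. if b then map_pmf Suc (?Q n) else ?Q n)"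
    using p
    by (auto simp: binomial_pmf_Suc pair_pmf_def map_pmf_def bind_assoc_pmf bind_return_pmf
        intro!: bind_pmf_cong)
  have S: "pmf (map_pmf Suc X) (Suc k) = pmf X k" "pmf (map_pmf Suc X) 0 = 0" for X and k :: nat
    by (auto intro: pmf_map_inj' pmf_map_outside)
  show "q (Suc n) 0 = (1 - p) * q n 0"
    "q (Suc n) (Suc k) = p * q n k + (1 - p) * q n (Suc k)"
    unfolding q_def * pmf_bind using p by (simp_all add: S mult.commute)
qed

text \<open>
  The case split of the introduction. For \<open>e \<le> B / 2\<close> only \<open>c \<le> 1 / 12\<close> matters; for \<open>e > B / 2\<close>
  the term with \<open>D\<close> is dropped, and the claim follows from \<open>p\<^sup>2 \<le> (1 - c) * (p + \<theta> * r / 2)\<^sup>2\<close>.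
\<close>

lemma kernel_quadratic_bound:
  fixes A B D e p r \<theta> c :: real
  assumes p: "p > 0" and r: "r \<ge> 0" and \<theta>: "\<theta> \<ge> 0"
    and c: "0 \<le> c" "c \<le> 1 / 12 * (1 - p\<^sup>2 / (p + \<theta> * r)\<^sup>2)"
    and A: "A \<ge> 0" and B: "B \<ge> 0"
    and Ae: "\<theta> * e \<le> A" and AD: "(B - e)\<^sup>2 / 2 \<le> A * D" and D: "D \<ge> 0"
  shows "c * (p * B + r * A)\<^sup>2 \<le> (p\<^sup>2 * D + 2 * p * r * B + r\<^sup>2 * A) * A"
proof -
  have "1 / 12 * (1 - p\<^sup>2 / (p + \<theta> * r)\<^sup>2) \<le> 1 / 12 * 1"
    by (intro mult_left_mono) auto
  with c(2) have c12: "c \<le> 1 / 12" by linarith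
  have expand: "(p\<^sup>2 * D + 2 * p * r * B + r\<^sup>2 * A) * A = p\<^sup>2 * (A * D) + ((p * B + r * A)\<^sup>2 - (p * B)\<^sup>2)"
    by (simp add: power2_eq_square algebra_simps)
  show ?thesis
  proof (cases "e \<le> B / 2")
    case True
    have "(B / 2)\<^sup>2 \<le> (B - e)\<^sup>2"
      using True B by (intro power_mono) auto
    moreover have "(B / 2)\<^sup>2 = B\<^sup>2 / 4" by (simp add: power_divide)
    ultimately have "B\<^sup>2 / 8 \<le> A * D"
      using AD by linarith
    hence "p\<^sup>2 * (B\<^sup>2 / 8) \<le> p\<^sup>2 * (A * D)"
      by (rule mult_left_mono) simp
    moreover have "(p * B)\<^sup>2 = p\<^sup>2 * B\<^sup>2" by (rule power_mult_distrib)
    ultimately have 1: "(p * B)\<^sup>2 / 12 \<le> p\<^sup>2 * (A * D)"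
      using zero_le_power2[of "p * B"] by linarith
    have "p * B \<le> p * B + r * A" using r A by simp
    hence 2: "(p * B)\<^sup>2 \<le> (p * B + r * A)\<^sup>2"
      using p B by (intro power_mono) auto
    have "c * (p * B + r * A)\<^sup>2 \<le> 1 / 12 * (p * B + r * A)\<^sup>2"
      using c12 by (rule mult_right_mono) simp
    thus ?thesis unfolding expand using 1 2 by linarith
  next
    case False
    have "\<theta> * (B / 2) \<le> \<theta> * e" using False \<theta> by (intro mult_left_mono) auto
    hence "r * (\<theta> * (B / 2)) \<le> r * A" using Ae r by (intro mult_left_mono) auto
    hence w: "B * (p + \<theta> * r / 2) \<le> p * B + r * A" by (simp add: algebra_simps)
    define h where "h = \<theta> * r"
    have h: "h \<ge> 0" using \<theta> r by (simp add: h_def)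
    have key: "p\<^sup>2 \<le> (1 - c) * (p + h / 2)\<^sup>2"
    proof -
      have "c * (p + h / 2)\<^sup>2 \<le> c * (p + h)\<^sup>2"
        using c p h by (intro mult_left_mono power_mono) auto
      also have "\<dots> \<le> 1 / 12 * (1 - p\<^sup>2 / (p + h)\<^sup>2) * (p + h)\<^sup>2"
        using c by (intro mult_right_mono) (auto simp: h_def)
      also have "\<dots> = 1 / 12 * ((p + h)\<^sup>2 - p\<^sup>2)"
        using p h by (simp add: field_simps)
      also have "\<dots> = 1 / 12 * (2 * (p * h) + h\<^sup>2)"
        by (simp add: power2_eq_square algebra_simps)
      also have "\<dots> \<le> p * h + h\<^sup>2 / 4"
        using p h by simp
      also have "\<dots> = (p + h / 2)\<^sup>2 - p\<^sup>2"
        by (simp add: power2_eq_square field_simps)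
      finally show ?thesis by (simp add: algebra_simps)
    qed
    have "(p * B)\<^sup>2 \<le> (1 - c) * (p + h / 2)\<^sup>2 * B\<^sup>2"
      using mult_right_mono[OF key, of "B\<^sup>2"] by (simp add: power_mult_distrib)
    also have "\<dots> = (1 - c) * (B * (p + \<theta> * r / 2))\<^sup>2"
      by (simp add: power_mult_distrib h_def)
    also have "\<dots> \<le> (1 - c) * (p * B + r * A)\<^sup>2"
      using w c12 B p h by (intro mult_left_mono power_mono) (auto simp: h_def)
    finally have "c * (p * B + r * A)\<^sup>2 \<le> (p * B + r * A)\<^sup>2 - (p * B)\<^sup>2"
      by (simp add: algebra_simps)
    moreover have "0 \<le> p\<^sup>2 * (A * D)" using A D by simp
    ultimately show ?thesis unfolding expand by linarith
  qed
qed

lemma binomial_poisson_log_convex: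
  fixes p \<theta> c :: real and n k :: nat
  assumes p: "0 < p" "p < 1" and \<theta>: "\<theta> > 0"
    and c: "0 \<le> c" "c \<le> 1 / 12 * (1 - p\<^sup>2 / (p + \<theta> * (1 - p))\<^sup>2)"
  defines "q \<equiv> \<lambda>n. pmf (map_pmf (\<lambda>(y, z). y + z) (pair_pmf (binomial_pmf n p) (poisson_pmf \<theta>)))"
  shows "c * (q (Suc n) k)\<^sup>2 \<le> q (Suc (Suc n)) k * q n k"
proof -
  have rec: "q (Suc m) 0 = (1 - p) * q m 0"
    "q (Suc m) (Suc i) = p * q m i + (1 - p) * q m (Suc i)" for m i
    unfolding q_def using p by (simp_all only: pmf_binomial_sum_Suc less_imp_le)
  note conv = poisson_convolution_bounds[of \<theta> "binomial_pmf n p", OF \<theta>]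
  define e where "e k = pmf (binomial_pmf n p) k * pmf (poisson_pmf \<theta>) 0" for k
  have nonneg: "q n k \<ge> 0" for k by (simp add: q_def)
  consider "k = 0" | "k = 1" | j where "k = Suc (Suc j)"
    by (metis One_nat_def not0_implies_Suc)
  thus ?thesis
  proof cases
    case 1
    have "1 / 12 * (1 - p\<^sup>2 / (p + \<theta> * (1 - p))\<^sup>2) \<le> 1 / 12 * 1"
      by (intro mult_left_mono) auto
    with c(2) have "c \<le> 1" by linarith
    hence "c * ((1 - p) * q n 0)\<^sup>2 \<le> 1 * ((1 - p) * q n 0)\<^sup>2"
      by (rule mult_right_mono) simp
    also have "\<dots> = q (Suc (Suc n)) 0 * q n 0"
      using p by (simp add: rec power2_eq_square)
    finally show ?thesis using p 1 by (simp add: rec)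
  next
    case 2
    have "c * (p * q n 0 + (1 - p) * q n 1)\<^sup>2
        \<le> (p\<^sup>2 * 0 + 2 * p * (1 - p) * q n 0 + (1 - p)\<^sup>2 * q n 1) * q n 1"
    proof (rule kernel_quadratic_bound[OF p(1) _ _ c nonneg nonneg, where e = "e 0"])
      show "\<theta> * e 0 \<le> q n 1" using conv(1)[of 0] by (simp only: q_def e_def One_nat_def)
      show "(q n 0 - e 0)\<^sup>2 / 2 \<le> q n 1 * 0" using conv(2) by (simp only: q_def e_def) simp
    qed (use p \<theta> in auto)
    moreover have "q (Suc n) 1 = p * q n 0 + (1 - p) * q n 1"
      using p by (simp add: rec)
    moreover have "q (Suc (Suc n)) 1 = p\<^sup>2 * 0 + 2 * p * (1 - p) * q n 0 + (1 - p)\<^sup>2 * q n 1"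
      using p by (simp add: rec power2_eq_square algebra_simps)
    ultimately show ?thesis unfolding 2 by (simp only:)
  next
    case 3
    let ?D = "q n j" and ?B = "q n (Suc j)" and ?A = "q n (Suc (Suc j))"
    have "c * (p * ?B + (1 - p) * ?A)\<^sup>2
        \<le> (p\<^sup>2 * ?D + 2 * p * (1 - p) * ?B + (1 - p)\<^sup>2 * ?A) * ?A"
    proof (rule kernel_quadratic_bound[OF p(1) _ _ c nonneg nonneg, where e = "e (Suc j)"])
      show "\<theta> * e (Suc j) \<le> ?A" using conv(1)[of "Suc j"] by (simp only: q_def e_def)
      show "(?B - e (Suc j))\<^sup>2 / 2 \<le> ?A * ?D" using conv(3)[of j] by (simp only: q_def e_def)
    qed (use p \<theta> nonneg in auto)
    moreover have "q (Suc n) (Suc (Suc j)) = p * ?B + (1 - p) * ?A"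
      using p by (simp add: rec)
    moreover have "q (Suc (Suc n)) (Suc (Suc j))
        = p\<^sup>2 * ?D + 2 * p * (1 - p) * ?B + (1 - p)\<^sup>2 * ?A"
      using p by (simp add: rec power2_eq_square algebra_simps)
    ultimately show ?thesis unfolding 3 by (simp only:)
  qed
qed

section \<open>The semi-group\<close>

text \<open>
  For positive values the product form of \<open>\<Delta> log g \<ge> log c\<close> implies the literal inequality.
\<close>

lemma Delta_log_geI:
  assumes c: "c > 0" and n: "n \<ge> 1" and pos: "\<And>m. g m > 0"
    and prod: "ennreal c * (g n)\<^sup>2 \<le> g (n + 1) * g (n - 1)"
  shows "Delta_log_ge g n (ln c)"
  unfolding Delta_log_ge_def
proof (intro conjI impI)
  show "ennreal (exp (ln c)) * (g n)\<^sup>2 \<le> g (n + 1) * g (n - 1)"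
    using prod c by simp
  assume fin: "g (n - 1) < \<infinity> \<and> g n < \<infinity> \<and> g (n + 1) < \<infinity>"
  define x y z where "x = enn2real (g (n - 1))" and "y = enn2real (g n)"
    and "z = enn2real (g (n + 1))"
  have eqs: "g (n - 1) = ennreal x" "g n = ennreal y" "g (n + 1) = ennreal z"
    using fin by (auto simp: x_def y_def z_def)
  have xyz: "x > 0" "y > 0" "z > 0"
    using fin pos by (auto simp: x_def y_def z_def enn2real_positive_iff)
  have "ennreal (c * y\<^sup>2) \<le> ennreal (z * x)"
    using prod c xyz unfolding eqs by (simp add: ennreal_mult ennreal_power)
  hence "c * y\<^sup>2 \<le> z * x"
    using xyz by (subst (asm) ennreal_le_iff) auto
  hence "ln (c * y\<^sup>2) \<le> ln (z * x)"
    using c xyz by (subst ln_le_cancel_iff) auto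
  hence "ln c + 2 * ln y \<le> ln z + ln x"
    using c xyz by (simp add: ln_mult ln_realpow)
  thus "ln c \<le> Delta (\<lambda>m. ln (enn2real (g m))) n"
    by (simp add: Delta_def x_def y_def z_def)
qed

theorem proposition3p1:
  fixes lam \<mu> \<rho> t p :: real and f :: "nat \<Rightarrow> real" and n :: nat
  assumes "lam > 0" and "\<mu> > 0" and "\<rho> = lam / \<mu>"
    and "\<And>k. f k \<ge> 0" and "\<exists>k. f k \<noteq> 0"
    and "t > 0" and "p = exp (- \<mu> * t)"
    and "n \<ge> 1"
  shows "Delta_log_ge (mm_inf_semigroup lam \<mu> t f) n
           (ln (1 / 12 * (1 - p\<^sup>2 / (p + \<rho> * (1 - p)\<^sup>2)\<^sup>2)))"
proof -
  define \<theta> where "\<theta> = \<rho> * (1 - p)"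
  define c where "c = 1 / 12 * (1 - p\<^sup>2 / (p + \<rho> * (1 - p)\<^sup>2)\<^sup>2)"
  define Q where "Q n = map_pmf (\<lambda>(y, z). y + z) (pair_pmf (binomial_pmf n p) (poisson_pmf \<theta>))"
    for n
  have p: "0 < p" "p < 1" using assms(2,6,7) by auto
  have \<theta>: "\<theta> > 0" using assms(1-3) p by (simp add: \<theta>_def)
  have c_eq: "c = 1 / 12 * (1 - p\<^sup>2 / (p + \<theta> * (1 - p))\<^sup>2)"
    by (simp add: c_def \<theta>_def power2_eq_square mult_ac)
  have "p\<^sup>2 < (p + \<theta> * (1 - p))\<^sup>2"
    using p \<theta> by (intro power_strict_mono) auto
  hence c: "c > 0"
    using p unfolding c_eq by (simp add: divide_less_eq)
  have S: "mm_inf_semigroup lam \<mu> t f m = (\<integral>\<^sup>+ k. ennreal (f k) \<partial>measure_pmf (Q m))" for m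
    using assms(3,6,7) by (simp add: mm_inf_semigroup_def mm_inf_pmf_def Q_def \<theta>_def)
  have Q_pos: "pmf (Q m) k > 0" for m k
  proof -
    have "0 < pmf (binomial_pmf m p) 0 * pmf (poisson_pmf \<theta>) (k - 0)"
      using p \<theta> by simp
    also have "\<dots> \<le> pmf (Q m) k"
      unfolding Q_def pmf_sum_pair_nat
      by (rule member_le_sum[where i = 0
            and f = "\<lambda>i. pmf (binomial_pmf m p) i * pmf (poisson_pmf \<theta>) (k - i)"]) auto
    finally show ?thesis .
  qed
  obtain k where k: "f k > 0" using assms(4,5) by (metis less_eq_real_def)
  have "Delta_log_ge (mm_inf_semigroup lam \<mu> t f) n (ln c)"
  proof (rule Delta_log_geI[OF c assms(8)])
    show "mm_inf_semigroup lam \<mu> t f m > 0" for m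
      unfolding S using k Q_pos by (rule nn_integral_pmf_pos)
    obtain m where m: "n = Suc m" using assms(8) by (cases n) auto
    have "c * (pmf (Q (Suc m)) k)\<^sup>2 \<le> pmf (Q (Suc (Suc m))) k * pmf (Q m) k" for k
      unfolding Q_def using p \<theta> c c_eq by (intro binomial_poisson_log_convex) auto
    thus "ennreal c * (mm_inf_semigroup lam \<mu> t f n)\<^sup>2
        \<le> mm_inf_semigroup lam \<mu> t f (n + 1) * mm_inf_semigroup lam \<mu> t f (n - 1)"
      unfolding S m using assms(4) c by (auto intro!: nn_integral_pmf_log_convex)
  qed
  thus ?thesis by (simp add: c_def)
qed

end
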